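(* Let $\alpha\in\mathbb{R}^m$. i) The vector $\alpha$ is rationally uniform if and only if the zonotope $Z_\alpha$ is generated by vectors in linear general position. ii) The zonotope $Z_\alpha$ is generated by vectors in linear general position if and only if the associated zonotope $Z_\alpha^\perp$ is.
   Context: For $\alpha\in\mathbb{R}^m$ let $\dim_{\mathbb{Q}}(\alpha)$ be the dimension of the $\mathbb{Q}$-vector space generated by the coordinates of $\alpha$; $\alpha$ is rationally uniform if every $\dim_{\mathbb{Q}}(\alpha)$ coordinates of $\alpha$ (at distinct positions) are linearly independent over $\mathbb{Q}$. Let $\Lambda_\alpha=\{l\in\mathbb{Z}^m\mid l\cdot\alpha=0\}$, let $V_\alpha$ be its real linear span, and $n=\dim V_\alpha$. Choose a basis $a_1,\dots,a_n$ of $\Lambda_\alpha$, extend it to a basis $a_1,\dots,a_m$ of $\mathbb{Z}^m$ (possible since $\Lambda_\alpha=V_\alpha\cap\mathbb{Z}^m$), and let $a_1^\star,\dots,a_m^\star$ be the dual basis, $a_i\cdot a_j^\star=\delta_{ij}$. Let $A$ be the $n\times m$ matrix with rows $a_1^\intercal,\dots,a_n^\intercal$ and $A^\perp$ the $(m-n)\times m$ matrix with rows $(a_{n+1}^\star)^\intercal,\dots,(a_m^\star)^\intercal$ (a basis of $V_\alpha^\perp\cap\mathbb{Z}^m$). The lattice zonotope $Z_\alpha\subseteq\mathbb{R}^n$ is the one generated by the columns $z_1,\dots,z_m$ of $A$, i.e. $Z_\alpha=\sum_{i=1}^m[0,z_i]$, and the associated zonotope $Z_\alpha^\perp\subseteq\mathbb{R}^{m-n}$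 is the one generated in the same way by the columns of $A^\perp$. (Different choices of bases change these by unimodular transformations only.) "Generated by vectors in linear general position" refers to these families of $m$ columns: a family of $m$ vectors in $\mathbb{R}^d$ is in linear general position if any $d$ of them (at distinct indices) are linearly independent. *)

theory Defs
  imports Complex_Main "Jordan_Normal_Form.VS_Connect"
begin

section \<open>Rational uniformity\<close>

interpretation rat_real: Vector_Spaces.vector_space "\<lambda>(q::rat) (x::real). of_rat q * x"
  by unfold_locales (simp_all add: algebra_simps of_rat_add of_rat_mult)

definition dim_rat :: "real vec \<Rightarrow> nat" where
  "dim_rat \<alpha> = rat_real.dim (rat_real.span (set\<^sub>v \<alpha>))"

text \<open>Coordinates are taken at distinct positions, so equal coordinates at different positions
  count as dependent; this is what the injectivity clause expresses.\<close>

definition rationally_uniform :: "real vec \<Rightarrow> bool" where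
  "rationally_uniform \<alpha> \<longleftrightarrow>
    (\<forall>J \<subseteq> {..<dim_vec \<alpha>}. card J = dim_rat \<alpha> \<longrightarrow>
      inj_on (\<lambda>j. \<alpha> $ j) J \<and> rat_real.independent ((\<lambda>j. \<alpha> $ j) ` J))"


section \<open>The relation lattice and bases\<close>

abbreviation real_of_int_vec :: "int vec \<Rightarrow> real vec" where
  "real_of_int_vec \<equiv> map_vec real_of_int"

definition relation_lattice :: "real vec \<Rightarrow> int vec set" where
  "relation_lattice \<alpha> = {l \<in> carrier_vec (dim_vec \<alpha>). real_of_int_vec l \<bullet> \<alpha> = 0}"

definition relation_space :: "real vec \<Rightarrow> real vec set" where
  "relation_space \<alpha> =
    LinearCombinations.module.span class_ring (module_vec TYPE(real) (dim_vec \<alpha>))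
      (real_of_int_vec ` relation_lattice \<alpha>)"

definition relation_dim :: "real vec \<Rightarrow> nat" where
  "relation_dim \<alpha> =
    vectorspace.dim class_ring
      (module_vec TYPE(real) (dim_vec \<alpha>) \<lparr>carrier := relation_space \<alpha>\<rparr>)"

text \<open>Here \<open>class_ring\<close> is the ring of integers, so span and linear dependence are over
  the integers: \<open>as\<close> lists a basis of the lattice \<open>L\<close> as a free abelian group.\<close>

definition lattice_basis :: "nat \<Rightarrow> int vec list \<Rightarrow> int vec set \<Rightarrow> bool" where
  "lattice_basis m as L \<longleftrightarrow>
    set as \<subseteq> carrier_vec m \<and> distinct as \<and>
    \<not> LinearCombinations.module.lin_dep class_ring (module_vec TYPE(int) m) (set as) \<and>
    LinearCombinations.module.span class_ring (module_vec TYPE(int) m) (set as) = L"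

definition dual_basis :: "nat \<Rightarrow> int vec list \<Rightarrow> real vec list \<Rightarrow> bool" where
  "dual_basis m as ds \<longleftrightarrow>
    length ds = length as \<and> set ds \<subseteq> carrier_vec m \<and>
    (\<forall>i < length as. \<forall>j < length as.
      real_of_int_vec (as ! i) \<bullet> ds ! j = (if i = j then 1 else 0))"


section \<open>Zonotopes\<close>

text \<open>Since \<open>M *\<^sub>v t\<close> is the sum of the \<open>t $ i\<close> multiples of the
  columns of \<open>M\<close>, this is the Minkowski sum of the segments from 0 to the columns.\<close>

definition zonotope :: "real mat \<Rightarrow> real vec set" where
  "zonotope M = {M *\<^sub>v t | t. t \<in> carrier_vec (dim_col M) \<and> (\<forall>i < dim_col M. t $ i \<in> {0..1})}"

text \<open>The columns are treated as a family: a repeated column makes any selection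
  containing both copies dependent.\<close>

definition linear_general_position :: "real mat \<Rightarrow> bool" where
  "linear_general_position M \<longleftrightarrow>
    (\<forall>J \<subseteq> {..<dim_col M}. card J = dim_row M \<longrightarrow>
      inj_on (col M) J \<and>
      \<not> LinearCombinations.module.lin_dep class_ring (module_vec TYPE(real) (dim_row M)) (col M ` J))"

text \<open>The property refers to the given generating family (the columns of \<open>M\<close>), not to
  the existence of some generating family of the set \<open>Z\<close>.\<close>

definition generated_in_general_position :: "real vec set \<Rightarrow> real mat \<Rightarrow> bool" where
  "generated_in_general_position Z M \<longleftrightarrow> Z = zonotope M \<and> linear_general_position M"

end

theory Submission
  imports Defs
begin

text \<open>
  Write \<open>k\<close> for the rank of the relation lattice, and fix a set \<open>J\<close> of \<open>m - k\<close> positions with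
  complement \<open>I\<close>, so that \<open>I\<close> has \<open>k\<close> elements. The three properties in the theorem, read at
  matching selections, all say that one and the same integer \<open>k \<times> k\<close> minor is nonzero: the minor
  of the relation matrix (rows \<open>a\<^sub>1, \<dots>, a\<^sub>k\<close>) on the columns in \<open>I\<close>.

  \<^item> The coordinates of \<open>\<alpha>\<close> at \<open>J\<close> are rationally dependent iff some nonzero integer relation is
    supported on \<open>J\<close> (clear denominators). Relations are the integer combinations of the rows
    \<open>a\<^sub>1, \<dots>, a\<^sub>k\<close>, so this says that an integer combination of the rows, with coefficients not all
    zero, vanishes on \<open>I\<close>.
  \<^item> The columns of the associated matrix at \<open>J\<close> are dependent iff its kernel contains a nonzero
    vector supported on \<open>J\<close>. By duality that kernel is the real row space of the relation
    matrix, so this says the same with real coefficients in place of integer ones.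
  \<^item> The columns of the relation matrix at \<open>I\<close> are dependent iff the minor has a nonzero right kernel
    vector, whereas the two previous conditions produce a nonzero left kernel vector.

  A square matrix over an integral domain has nonzero determinant iff it has trivial left kernel
  iff it has trivial right kernel, and the determinant does not change from the integers to the
  reals; so the three conditions agree (\<open>complementary_selections\<close>). It remains to know that
  rational uniformity tests selections of exactly \<open>m - k\<close> coordinates, that is, that
  \<open>dim_rat \<alpha> = m - k\<close>: the products of \<open>\<alpha>\<close> with the last \<open>m - k\<close> lattice basis vectors form a
  basis of the rational span of its coordinates (\<open>dim_rat_alpha\<close>).
\<close>

section \<open>Independence of families of real numbers over the rationals\<close>

lemma finite_rats_common_denominator:
  fixes S :: "rat set"
  assumes "finite S"
  shows "\<exists>d::int. d \<noteq> 0 \<and> (\<forall>q\<in>S. of_int d * q \<in> \<int>)"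
  using assms
proof (induction S)
  case empty
  show ?case by (intro exI[of _ 1]) auto
next
  case (insert q S)
  obtain d :: int where d: "d \<noteq> 0" "\<forall>q\<in>S. of_int d * q \<in> \<int>" using insert.IH by blast
  obtain e p :: int where e: "e \<noteq> 0" "q = of_int p / of_int e"
    by (metis Fract_of_int_quotient Rat_cases less_irrefl)
  have "of_int (d * e) * q \<in> \<int>" using e by simp
  moreover have "of_int (d * e) * r \<in> \<int>" if "r \<in> S" for r
  proof -
    have "of_int (d * e) * r = of_int e * (of_int d * r)" by simp
    then show ?thesis using d(2) that by (metis Ints_mult Ints_of_int)
  qed
  ultimately show ?case using d(1) e(1) by (intro exI[of _ "d * e"]) auto
qed

text \<open>Clearing denominators turns a rational relation into an integer one. The injectivity clause is
  what makes the family statement right: equal members at different positions \<open>i\<close>, \<open>j\<close> give the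
  relation with coefficients \<open>1\<close> and \<open>- 1\<close>.\<close>
lemma rat_family_independent_iff:
  fixes x :: "'i \<Rightarrow> real"
  assumes J: "finite J"
  shows "inj_on x J \<and> rat_real.independent (x ` J) \<longleftrightarrow>
    (\<forall>c::'i \<Rightarrow> int. (\<Sum>j\<in>J. of_int (c j) * x j) = 0 \<longrightarrow> (\<forall>j\<in>J. c j = 0))"
    (is "?ind \<longleftrightarrow> ?norel")
proof
  assume ind: ?ind
  show ?norel
  proof (intro allI impI ballI)
    fix c :: "'i \<Rightarrow> int" and j
    assume c: "(\<Sum>j\<in>J. of_int (c j) * x j) = 0" and j: "j \<in> J"
    define u where "u v = rat_of_int (c (inv_into J x v))" for v
    have u: "u (x i) = of_int (c i)" if "i \<in> J" for i
      using ind that by (simp add: u_def inv_into_f_f)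
    have "(\<Sum>v\<in>x ` J. of_rat (u v) * v) = (\<Sum>j\<in>J. of_rat (u (x j)) * x j)"
      using ind by (simp add: sum.reindex)
    also have "\<dots> = 0" using c u by simp
    finally have "u (x j) = 0"
      using ind j J rat_real.dependent_finite[of "x ` J"] by blast
    then show "c j = 0" using u[OF j] by simp
  qed
next
  assume norel: ?norel
  have inj: "inj_on x J"
  proof (rule inj_onI, rule ccontr)
    fix i j assume ij: "i \<in> J" "j \<in> J" "x i = x j" "i \<noteq> j"
    define c :: "'i \<Rightarrow> int" where "c l = (if l = i then 1 else if l = j then - 1 else 0)" for l
    have "(\<Sum>l\<in>J. of_int (c l) * x l) =
        (\<Sum>l\<in>J. (if l = i then x l else 0) + (if l = j then - x l else 0))"
      by (rule sum.cong) (use ij in \<open>auto simp: c_def\<close>)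
    also have "\<dots> = 0" using ij J by (simp add: sum.distrib)
    finally show False using norel ij(1) by (force simp: c_def)
  qed
  moreover have "rat_real.independent (x ` J)"
  proof
    assume "rat_real.dependent (x ` J)"
    then obtain u i where u: "(\<Sum>v\<in>x ` J. of_rat (u v) * v) = 0" and i: "i \<in> J" "u (x i) \<noteq> 0"
      using J rat_real.dependent_finite[of "x ` J"] by auto
    obtain d :: int where d: "d \<noteq> 0" "\<forall>q\<in>u ` x ` J. of_int d * q \<in> \<int>"
      using finite_rats_common_denominator[of "u ` x ` J"] J by auto
    define c where "c j = \<lfloor>of_int d * u (x j)\<rfloor>" for j
    have c: "rat_of_int (c j) = of_int d * u (x j)" if "j \<in> J" for j
      using d(2) that by (auto simp: c_def)
    have c': "real_of_int (c j) = of_int d * of_rat (u (x j))" if "j \<in> J" for j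
      using arg_cong[OF c[OF that], of real_of_rat] by (simp add: of_rat_mult)
    have "(\<Sum>j\<in>J. of_int (c j) * x j) = of_int d * (\<Sum>j\<in>J. of_rat (u (x j)) * x j)"
      by (simp add: c' sum_distrib_left mult.assoc)
    also have "(\<Sum>j\<in>J. of_rat (u (x j)) * x j) = 0"
      using u inj by (simp add: sum.reindex)
    finally have "c i = 0" using norel i(1) by simp
    then show False using c[OF i(1)] d(1) i(2) by simp
  qed
  ultimately show ?ind by blast
qed

section \<open>Column selections, kernels and minors\<close>

definition independent_columns :: "real mat \<Rightarrow> nat set \<Rightarrow> bool" where
  "independent_columns M J \<longleftrightarrow> inj_on (col M) J \<and>
    \<not> LinearCombinations.module.lin_dep class_ring (module_vec TYPE(real) (dim_row M)) (col M ` J)"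

lemma linear_general_position_iff:
  "linear_general_position M \<longleftrightarrow>
    (\<forall>J\<subseteq>{..<dim_col M}. card J = dim_row M \<longrightarrow> independent_columns M J)"
  by (simp add: linear_general_position_def independent_columns_def)

text \<open>A vector supported on \<open>J\<close> is the same thing as a choice of coefficients for the columns
  in \<open>J\<close>. In this form no choice of an enumeration of \<open>J\<close> or of a submatrix is involved.\<close>
lemma independent_columns_iff_no_supported_kernel:
  fixes M :: "real mat"
  assumes M: "M \<in> carrier_mat d m" and J: "J \<subseteq> {..<m}"
  shows "independent_columns M J \<longleftrightarrow>
    (\<forall>t\<in>carrier_vec m. (\<forall>j<m. j \<notin> J \<longrightarrow> t $ j = 0) \<longrightarrow> M *\<^sub>v t = 0\<^sub>v d \<longrightarrow> t = 0\<^sub>v m)"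
    (is "_ \<longleftrightarrow> ?noker")
proof -
  interpret vec_space "TYPE(real)" d .
  have fin: "finite J" using J finite_subset by blast
  have cols: "col M ` J \<subseteq> carrier_vec d" using M by auto
  have Mt: "(M *\<^sub>v t) $ i = (\<Sum>j\<in>J. t $ j * col M j $ i)"
    if "t \<in> carrier_vec m" "\<forall>j<m. j \<notin> J \<longrightarrow> t $ j = 0" "i < d" for t i
  proof -
    have "(M *\<^sub>v t) $ i = (\<Sum>j\<in>{..<m}. t $ j * col M j $ i)"
      using M that by (auto simp: scalar_prod_def mult.commute lessThan_atLeast0 intro!: sum.cong)
    also have "\<dots> = (\<Sum>j\<in>J. t $ j * col M j $ i)"
      by (rule sum.mono_neutral_right) (use J that in auto)
    finally show ?thesis .
  qed
  have Mlin: "(M *\<^sub>v t) = lincomb u (col M ` J)"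
    if "inj_on (col M) J" "t \<in> carrier_vec m" "\<forall>j<m. j \<notin> J \<longrightarrow> t $ j = 0"
      "\<forall>j\<in>J. u (col M j) = t $ j" for t u
  proof (rule eq_vecI)
    show "dim_vec (M *\<^sub>v t) = dim_vec (lincomb u (col M ` J))"
      using M lincomb_dim[OF _ cols] fin by simp
    fix i assume "i < dim_vec (lincomb u (col M ` J))"
    then have i: "i < d" using lincomb_dim[OF _ cols] fin by simp
    show "(M *\<^sub>v t) $ i = lincomb u (col M ` J) $ i"
      unfolding Mt[OF that(2,3) i] lincomb_index[OF i cols]
      using that by (simp add: sum.reindex)
  qed
  have unfold: "independent_columns M J \<longleftrightarrow> inj_on (col M) J \<and> lin_indpt (col M ` J)"
    using M by (simp add: independent_columns_def)
  show ?thesis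
    unfolding unfold
  proof
    assume ind: "inj_on (col M) J \<and> lin_indpt (col M ` J)"
    show ?noker
    proof (intro ballI impI)
      fix t assume t: "t \<in> carrier_vec m" "\<forall>j<m. j \<notin> J \<longrightarrow> t $ j = 0" "M *\<^sub>v t = 0\<^sub>v d"
      define u where "u v = t $ inv_into J (col M) v" for v
      have u: "u (col M j) = t $ j" if "j \<in> J" for j
        using ind that by (simp add: u_def inv_into_f_f)
      have "lincomb u (col M ` J) = 0\<^sub>v d" using Mlin[of t u] ind t u by simp
      then have "u (col M j) = 0" if "j \<in> J" for j
        using not_lindepD[of "col M ` J" "col M ` J" u] ind fin that by auto
      then show "t = 0\<^sub>v m" using t u by (intro eq_vecI) auto
    qed
  next
    assume noker: ?noker
    have inj: "inj_on (col M) J"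
    proof (rule inj_onI, rule ccontr)
      fix i j assume ij: "i \<in> J" "j \<in> J" "col M i = col M j" "i \<noteq> j"
      define t :: "real vec" where "t = vec m (\<lambda>l. if l = i then 1 else if l = j then - 1 else 0)"
      have t: "t \<in> carrier_vec m" "\<forall>l<m. l \<notin> J \<longrightarrow> t $ l = 0"
        using ij by (auto simp: t_def)
      have "M *\<^sub>v t = 0\<^sub>v d"
      proof (rule eq_vecI)
        fix l assume "l < dim_vec (0\<^sub>v d :: real vec)"
        then have l: "l < d" by simp
        have "(M *\<^sub>v t) $ l =
            (\<Sum>q\<in>J. (if q = i then col M q $ l else 0) + (if q = j then - col M q $ l else 0))"
          unfolding Mt[OF t l] by (rule sum.cong) (use ij J in \<open>auto simp: t_def\<close>)
        also have "\<dots> = 0" using ij fin by (simp add: sum.distrib)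
        finally show "(M *\<^sub>v t) $ l = 0\<^sub>v d $ l" using l by simp
      qed (use M in auto)
      then have "t = 0\<^sub>v m" using noker t by blast
      then have "t $ i = 0" using ij(1) J by auto
      then show False using ij(1) J by (auto simp: t_def)
    qed
    moreover have "lin_indpt (col M ` J)"
    proof (rule finite_lin_indpt2)
      fix u assume u: "lincomb u (col M ` J) = 0\<^sub>v d"
      define t where "t = vec m (\<lambda>j. if j \<in> J then u (col M j) else 0)"
      have t: "t \<in> carrier_vec m" "\<forall>j<m. j \<notin> J \<longrightarrow> t $ j = 0" by (auto simp: t_def)
      have tu: "\<forall>j\<in>J. u (col M j) = t $ j" using J by (auto simp: t_def)
      have "t = 0\<^sub>v m" using noker t Mlin[OF inj t tu] u by auto
      then show "\<forall>v\<in>col M ` J. u v = 0" using tu J by auto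
    qed (use fin cols in auto)
    ultimately show "inj_on (col M) J \<and> lin_indpt (col M ` J)" by blast
  qed
qed

text \<open>The two ways in which a \<open>k \<times> k\<close> minor can be seen to vanish, stated for the whole matrix:
  vectors on the selected columns extend by zero to vectors of full length, while the rows of the
  minor are restrictions of full rows. Both directions hold over any integral domain, which is what
  allows the passage from integer to real coefficients below.\<close>
lemma
  fixes M :: "'a::idom mat" and e :: "nat \<Rightarrow> nat" and k m :: nat and I :: "nat set"
  defines "N \<equiv> mat k k (\<lambda>(i, j). M $$ (i, e j))"
  assumes M: "M \<in> carrier_mat k m" and e: "bij_betw e {..<k} I" and I: "I \<subseteq> {..<m}"
  shows minor_nonzero_iff_columns:
      "det N \<noteq> 0 \<longleftrightarrow>
        (\<forall>t\<in>carrier_vec m. (\<forall>j<m. j \<notin> I \<longrightarrow> t $ j = 0) \<longrightarrow> M *\<^sub>v t = 0\<^sub>v k \<longrightarrow> t = 0\<^sub>v m)"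
    and minor_nonzero_iff_rows:
      "det N \<noteq> 0 \<longleftrightarrow>
        (\<forall>c\<in>carrier_vec k. (\<forall>j\<in>I. (M\<^sup>T *\<^sub>v c) $ j = 0) \<longrightarrow> c = 0\<^sub>v k)"
proof -
  have N: "N \<in> carrier_mat k k" by (simp add: N_def)
  have e_lt: "e j < m" if "j < k" for j
    using e I that by (auto simp: bij_betw_def)
  have Nt: "N *\<^sub>v vec k (\<lambda>j. t $ e j) = M *\<^sub>v t"
    if "t \<in> carrier_vec m" "\<forall>j<m. j \<notin> I \<longrightarrow> t $ j = 0" for t
  proof (rule eq_vecI)
    fix i assume "i < dim_vec (M *\<^sub>v t)"
    then have i: "i < k" using M by simp
    have "(M *\<^sub>v t) $ i = (\<Sum>j\<in>{..<m}. M $$ (i, j) * t $ j)"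
      using M that i by (auto simp: scalar_prod_def lessThan_atLeast0 intro!: sum.cong)
    also have "\<dots> = (\<Sum>j\<in>I. M $$ (i, j) * t $ j)"
      by (rule sum.mono_neutral_right) (use I that in auto)
    also have "\<dots> = (\<Sum>j<k. M $$ (i, e j) * t $ e j)"
      by (rule sum.reindex_bij_betw[OF e, symmetric])
    also have "\<dots> = (N *\<^sub>v vec k (\<lambda>j. t $ e j)) $ i"
      using i by (auto simp: N_def scalar_prod_def lessThan_atLeast0 intro!: sum.cong)
    finally show "(N *\<^sub>v vec k (\<lambda>j. t $ e j)) $ i = (M *\<^sub>v t) $ i" ..
  qed (use M N in auto)
  show "det N \<noteq> 0 \<longleftrightarrow>
    (\<forall>t\<in>carrier_vec m. (\<forall>j<m. j \<notin> I \<longrightarrow> t $ j = 0) \<longrightarrow> M *\<^sub>v t = 0\<^sub>v k \<longrightarrow> t = 0\<^sub>v m)"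
  proof
    assume det: "det N \<noteq> 0"
    show "\<forall>t\<in>carrier_vec m. (\<forall>j<m. j \<notin> I \<longrightarrow> t $ j = 0) \<longrightarrow> M *\<^sub>v t = 0\<^sub>v k \<longrightarrow> t = 0\<^sub>v m"
    proof (intro ballI impI)
      fix t assume t: "t \<in> carrier_vec m" "\<forall>j<m. j \<notin> I \<longrightarrow> t $ j = 0" "M *\<^sub>v t = 0\<^sub>v k"
      have "v = 0\<^sub>v k" if "v \<in> carrier_vec k" "N *\<^sub>v v = 0\<^sub>v k" for v
        using det det_0_iff_vec_prod_zero[OF N] that by blast
      from this[OF vec_carrier] have "vec k (\<lambda>j. t $ e j) = 0\<^sub>v k"
        using Nt[OF t(1,2)] t(3) by simp
      then have "t $ e j = 0" if "j < k" for j
        using that by (auto simp: vec_eq_iff)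
      then have "t $ j = 0" if "j \<in> I" for j
        using that e by (auto simp: bij_betw_def)
      then show "t = 0\<^sub>v m" using t by (intro eq_vecI) auto
    qed
  next
    assume noker: "\<forall>t\<in>carrier_vec m.
      (\<forall>j<m. j \<notin> I \<longrightarrow> t $ j = 0) \<longrightarrow> M *\<^sub>v t = 0\<^sub>v k \<longrightarrow> t = 0\<^sub>v m"
    have "v = 0\<^sub>v k" if v: "v \<in> carrier_vec k" "N *\<^sub>v v = 0\<^sub>v k" for v
    proof -
      define t where "t = vec m (\<lambda>j. if j \<in> I then v $ inv_into {..<k} e j else 0)"
      have t: "t \<in> carrier_vec m" "\<forall>j<m. j \<notin> I \<longrightarrow> t $ j = 0" by (auto simp: t_def)
      have te: "t $ e j = v $ j" if "j < k" for j
        using e that e_lt[OF that] by (auto simp: t_def bij_betw_def inv_into_f_f)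
      then have "vec k (\<lambda>j. t $ e j) = v" using v by (intro eq_vecI) auto
      then have "t = 0\<^sub>v m" using noker t Nt[OF t] v by auto
      then have "v $ j = 0" if "j < k" for j
        using te[OF that] e_lt[OF that] by simp
      then show ?thesis using v by (intro eq_vecI) auto
    qed
    then show "det N \<noteq> 0" using det_0_iff_vec_prod_zero[OF N] by blast
  qed
  have NT: "(N\<^sup>T *\<^sub>v c) $ j = (M\<^sup>T *\<^sub>v c) $ e j" if "c \<in> carrier_vec k" "j < k" for c j
    using M that e_lt[OF that(2)]
    by (auto simp: N_def scalar_prod_def intro!: sum.cong)
  have NT0: "N\<^sup>T *\<^sub>v c = 0\<^sub>v k \<longleftrightarrow> (\<forall>j\<in>I. (M\<^sup>T *\<^sub>v c) $ j = 0)" if c: "c \<in> carrier_vec k" for c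
  proof -
    have "N\<^sup>T *\<^sub>v c = 0\<^sub>v k \<longleftrightarrow> (\<forall>j<k. (N\<^sup>T *\<^sub>v c) $ j = 0)"
      using N by (auto simp: vec_eq_iff)
    also have "\<dots> \<longleftrightarrow> (\<forall>j\<in>e ` {..<k}. (M\<^sup>T *\<^sub>v c) $ j = 0)"
      using NT[OF c] by auto
    also have "e ` {..<k} = I" using e by (simp add: bij_betw_def)
    finally show ?thesis .
  qed
  have "det N = det N\<^sup>T" using det_transpose[OF N] by simp
  then show "det N \<noteq> 0 \<longleftrightarrow>
    (\<forall>c\<in>carrier_vec k. (\<forall>j\<in>I. (M\<^sup>T *\<^sub>v c) $ j = 0) \<longrightarrow> c = 0\<^sub>v k)"
    using det_0_iff_vec_prod_zero[of "N\<^sup>T" k] N NT0 by auto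
qed

section \<open>Lattice bases as matrices\<close>
lemma lattice_basis_coordinates:
  assumes "lattice_basis m bs L"
  shows "L = {(mat_of_rows m bs)\<^sup>T *\<^sub>v c | c. c \<in> carrier_vec (length bs)}"
proof -
  interpret idom_vec m "TYPE(int)" .
  have bs: "set bs \<subseteq> carrier_vec m" and L: "L = span (set bs)"
    using assms by (auto simp: lattice_basis_def)
  have "lincomb_list f bs = (mat_of_rows m bs)\<^sup>T *\<^sub>v vec (length bs) f" for f
    using lincomb_list_as_mat_mult[of bs f] bs carrier_vecD
    by (auto simp: transpose_mat_of_rows subset_iff)
  moreover have "c = vec (length bs) (\<lambda>i. c $ i)" if "c \<in> carrier_vec (length bs)" for c :: "int vec"
    using that by auto
  ultimately show ?thesis
    unfolding L span_list_as_span[OF bs, symmetric] span_list_def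
    by simp (metis vec_carrier)
qed

text \<open>Combinations of the first \<open>k\<close> vectors are combinations of all of them with zero
  coefficients at the end; this lets the inverse of the full basis matrix act on them.\<close>
lemma transpose_mat_of_rows_take:
  fixes bs :: "'a::comm_semiring_1 vec list"
  assumes bs: "set bs \<subseteq> carrier_vec m" and k: "k \<le> length bs" and c: "c \<in> carrier_vec k"
  shows "(mat_of_rows m (take k bs))\<^sup>T *\<^sub>v c =
    (mat_of_rows m bs)\<^sup>T *\<^sub>v vec (length bs) (\<lambda>i. if i < k then c $ i else 0)"
proof (rule eq_vecI)
  fix j assume "j < dim_vec ((mat_of_rows m bs)\<^sup>T *\<^sub>v vec (length bs) (\<lambda>i. if i < k then c $ i else 0))"
  then have j: "j < m" by simp
  have "((mat_of_rows m bs)\<^sup>T *\<^sub>v vec (length bs) (\<lambda>i. if i < k then c $ i else 0)) $ j =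
      (\<Sum>i\<in>{0..<length bs}. bs ! i $ j * (if i < k then c $ i else 0))"
    using j by (auto simp: scalar_prod_def mat_of_rows_index intro!: sum.cong)
  also have "\<dots> = (\<Sum>i\<in>{0..<k}. bs ! i $ j * c $ i)"
    using k by (intro sum.mono_neutral_cong_right) auto
  also have "\<dots> = ((mat_of_rows m (take k bs))\<^sup>T *\<^sub>v c) $ j"
    using j k c by (auto simp: scalar_prod_def mat_of_rows_index min_absorb2 intro!: sum.cong)
  finally show "((mat_of_rows m (take k bs))\<^sup>T *\<^sub>v c) $ j =
      ((mat_of_rows m bs)\<^sup>T *\<^sub>v vec (length bs) (\<lambda>i. if i < k then c $ i else 0)) $ j" ..
qed simp

lemma mat_of_rows_real_of_int:
  assumes "set bs \<subseteq> carrier_vec m"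
  shows "mat_of_rows m (map real_of_int_vec bs) = map_mat real_of_int (mat_of_rows m bs)"
  using assms by (intro eq_matI) (auto simp: mat_of_rows_index subset_iff)

lemma transpose_mult_scalar_prod:
  assumes M: "M \<in> carrier_mat r m" and c: "c \<in> carrier_vec r" and x: "x \<in> carrier_vec m"
  shows "real_of_int_vec (M\<^sup>T *\<^sub>v c) \<bullet> x =
    (\<Sum>i<r. of_int (c $ i) * (real_of_int_vec (row M i) \<bullet> x))"
proof -
  have "real_of_int_vec (M\<^sup>T *\<^sub>v c) \<bullet> x =
      (\<Sum>j\<in>{0..<m}. \<Sum>i\<in>{0..<r}. of_int (M $$ (i, j)) * of_int (c $ i) * x $ j)"
    using M c x by (auto simp: scalar_prod_def sum_distrib_right intro!: sum.cong)
  also have "\<dots> = (\<Sum>i\<in>{0..<r}. \<Sum>j\<in>{0..<m}. of_int (M $$ (i, j)) * of_int (c $ i) * x $ j)"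
    by (rule sum.swap)
  also have "\<dots> = (\<Sum>i<r. of_int (c $ i) * (real_of_int_vec (row M i) \<bullet> x))"
    using M c x
    by (auto simp: scalar_prod_def sum_distrib_left lessThan_atLeast0 mult_ac intro!: sum.cong)
  finally show ?thesis .
qed

section \<open>A lattice basis adapted to the relations\<close>

locale adapted_basis =
  fixes m k :: nat and \<alpha> :: "real vec" and a :: "int vec list" and b :: "real vec list"
  assumes alpha: "\<alpha> \<in> carrier_vec m"
    and length_a: "length a = m"
    and k_le: "k \<le> m"
    and relation_basis: "lattice_basis m (take k a) (relation_lattice \<alpha>)"
    and basis: "lattice_basis m a (carrier_vec m)"
    and dual: "dual_basis m a b"
begin

definition basis_mat :: "int mat" where "basis_mat = mat_of_rows m a"
definition relation_mat :: "int mat" where "relation_mat = mat_of_rows m (take k a)"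
definition dual_mat :: "real mat" where "dual_mat = mat_of_rows m b"

abbreviation "basis_mat_real \<equiv> map_mat real_of_int basis_mat"
abbreviation "relation_mat_real \<equiv> map_mat real_of_int relation_mat"

lemma a_carrier: "set a \<subseteq> carrier_vec m"
  using basis by (simp add: lattice_basis_def)

lemma length_b: "length b = m" and b_carrier: "set b \<subseteq> carrier_vec m"
  using dual length_a by (auto simp: dual_basis_def)

lemma basis_mat_carrier [simp]: "basis_mat \<in> carrier_mat m m"
  and relation_mat_carrier [simp]: "relation_mat \<in> carrier_mat k m"
  and dual_mat_carrier [simp]: "dual_mat \<in> carrier_mat m m"
  using length_a k_le length_b by (auto simp: basis_mat_def relation_mat_def dual_mat_def)

lemmas mat_dims [simp] = carrier_matD[OF basis_mat_carrier] carrier_matD[OF relation_mat_carrier]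
  carrier_matD[OF dual_mat_carrier]

definition pad :: "'a::zero vec \<Rightarrow> 'a vec" where
  "pad c = vec m (\<lambda>i. if i < k then c $ i else 0)"

lemma pad_carrier [simp]: "pad c \<in> carrier_vec m" by (simp add: pad_def)

lemma relation_mat_transpose: "c \<in> carrier_vec k \<Longrightarrow> relation_mat\<^sup>T *\<^sub>v c = basis_mat\<^sup>T *\<^sub>v pad c"
  using transpose_mat_of_rows_take[OF a_carrier, of k c] k_le length_a
  by (simp add: relation_mat_def basis_mat_def pad_def)

lemma relation_mat_real_transpose:
  assumes "c \<in> carrier_vec k"
  shows "relation_mat_real\<^sup>T *\<^sub>v c = basis_mat_real\<^sup>T *\<^sub>v pad c"
proof -
  have tk: "set (take k a) \<subseteq> carrier_vec m" using a_carrier set_take_subset by fast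
  have "set (map real_of_int_vec a) \<subseteq> carrier_vec m" using a_carrier by auto
  from transpose_mat_of_rows_take[OF this, of k c] show ?thesis
    using k_le length_a assms
    by (simp add: relation_mat_def basis_mat_def pad_def mat_of_rows_real_of_int[OF a_carrier, symmetric]
        mat_of_rows_real_of_int[OF tk, symmetric] take_map)
qed

text \<open>The duality relations are the entries of this matrix equation. A one-sided inverse of a square
  matrix is two-sided, which gives the expansion of a vector in the basis \<open>a\<close>.\<close>
lemma dual_basis_inverse: "dual_mat * basis_mat_real\<^sup>T = 1\<^sub>m m"
proof (rule eq_matI)
  fix i j assume "i < dim_row (1\<^sub>m m :: real mat)" "j < dim_col (1\<^sub>m m :: real mat)"
  then have ij: "i < m" "j < m" by auto
  have aj: "a ! j \<in> carrier_vec m" and bi: "b ! i \<in> carrier_vec m"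
    using ij a_carrier b_carrier length_a length_b by auto
  have "(dual_mat * basis_mat_real\<^sup>T) $$ (i, j) = row dual_mat i \<bullet> row basis_mat_real j"
    using ij by simp
  also have "row basis_mat_real j = real_of_int_vec (a ! j)"
    using ij aj length_a by (intro eq_vecI) (auto simp: basis_mat_def mat_of_rows_index)
  also have "row dual_mat i = b ! i" using ij bi length_b by (auto simp: dual_mat_def)
  also have "b ! i \<bullet> real_of_int_vec (a ! j) = real_of_int_vec (a ! j) \<bullet> b ! i"
    using aj bi by (intro comm_scalar_prod[of _ m]) auto
  also have "\<dots> = (1\<^sub>m m) $$ (i, j)"
    using dual ij length_a by (auto simp: dual_basis_def)
  finally show "(dual_mat * basis_mat_real\<^sup>T) $$ (i, j) = (1\<^sub>m m) $$ (i, j)" .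
qed auto

lemma basis_dual_inverse: "basis_mat_real\<^sup>T * dual_mat = 1\<^sub>m m"
  using mat_mult_left_right_inverse[OF dual_mat_carrier _ dual_basis_inverse] by simp

lemma dual_basis_inverse_mult: "v \<in> carrier_vec m \<Longrightarrow> dual_mat *\<^sub>v (basis_mat_real\<^sup>T *\<^sub>v v) = v"
  by (subst assoc_mult_mat_vec[symmetric, of _ m m _ m])
    (use dual_basis_inverse in auto)

lemma basis_dual_inverse_mult: "v \<in> carrier_vec m \<Longrightarrow> basis_mat_real\<^sup>T *\<^sub>v (dual_mat *\<^sub>v v) = v"
  by (subst assoc_mult_mat_vec[symmetric, of _ m m _ m])
    (use basis_dual_inverse in auto)

text \<open>The inverse of the basis matrix is available over the reals, so integer vectors are compared
  after embedding them there.\<close>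
lemma basis_mat_inject:
  assumes "v \<in> carrier_vec m" "w \<in> carrier_vec m" "basis_mat\<^sup>T *\<^sub>v v = basis_mat\<^sup>T *\<^sub>v w"
  shows "v = w"
proof -
  have hom: "real_of_int_vec (basis_mat\<^sup>T *\<^sub>v u) = basis_mat_real\<^sup>T *\<^sub>v real_of_int_vec u" if "u \<in> carrier_vec m" for u
    using of_int_hom.mult_mat_vec_hom[of "basis_mat\<^sup>T" m m u] that
    by (simp add: map_mat_transpose)
  have "real_of_int_vec v = dual_mat *\<^sub>v (basis_mat_real\<^sup>T *\<^sub>v real_of_int_vec v)"
    using assms(1) by (simp add: dual_basis_inverse_mult)
  also have "\<dots> = dual_mat *\<^sub>v (basis_mat_real\<^sup>T *\<^sub>v real_of_int_vec w)"
    by (simp only: hom[OF assms(1), symmetric] hom[OF assms(2), symmetric] assms(3))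
  also have "\<dots> = real_of_int_vec w" using assms(2) by (simp add: dual_basis_inverse_mult)
  finally show ?thesis using assms(1,2) by (auto simp: vec_eq_iff)
qed

lemma pad_inject:
  assumes "c \<in> carrier_vec k" "pad c = 0\<^sub>v m"
  shows "c = 0\<^sub>v k"
proof (rule eq_vecI)
  fix i assume "i < dim_vec (0\<^sub>v k :: 'a vec)"
  then show "c $ i = 0\<^sub>v k $ i"
    using arg_cong[OF assms(2), of "\<lambda>v. v $ i"] k_le by (simp add: pad_def)
qed (use assms in auto)

lemma relation_lattice_eq: "relation_lattice \<alpha> = {relation_mat\<^sup>T *\<^sub>v c | c. c \<in> carrier_vec k}"
  using lattice_basis_coordinates[OF relation_basis] length_a k_le by (simp add: relation_mat_def min_absorb2)

text \<open>Since \<open>a\<close> and \<open>b\<close> are dual, the coefficient of \<open>t\<close> at \<open>a ! i\<close> is \<open>b ! i \<bullet> t\<close>. The last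
  \<open>m - k\<close> coefficients vanish exactly when \<open>t\<close> is a combination of the first \<open>k\<close> basis vectors.\<close>
lemma kernel_annihilator_rows:
  assumes t: "t \<in> carrier_vec m"
  shows "mat_of_rows m (drop k b) *\<^sub>v t = 0\<^sub>v (m - k) \<longleftrightarrow>
    (\<exists>c\<in>carrier_vec k. t = relation_mat_real\<^sup>T *\<^sub>v c)"
proof -
  have "mat_of_rows m (drop k b) *\<^sub>v t = 0\<^sub>v (m - k) \<longleftrightarrow> (\<forall>i<m - k. b ! (k + i) \<bullet> t = 0)"
    using length_b k_le b_carrier by (auto simp: vec_eq_iff subset_iff)
  also have "\<dots> \<longleftrightarrow> (\<forall>i<m. k \<le> i \<longrightarrow> (dual_mat *\<^sub>v t) $ i = 0)"
  proof -
    have "(dual_mat *\<^sub>v t) $ i = b ! i \<bullet> t" if "i < m" for i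
      using that length_b b_carrier by (auto simp: dual_mat_def subset_iff)
    moreover have "(\<forall>i<m - k. Q (k + i)) \<longleftrightarrow> (\<forall>i<m. k \<le> i \<longrightarrow> Q i)" for Q
      by (auto simp: less_diff_conv add.commute dest: le_Suc_ex)
    ultimately show ?thesis by simp
  qed
  also have "\<dots> \<longleftrightarrow> (\<exists>c\<in>carrier_vec k. dual_mat *\<^sub>v t = pad c)"
  proof
    assume "\<forall>i<m. k \<le> i \<longrightarrow> (dual_mat *\<^sub>v t) $ i = 0"
    then have "dual_mat *\<^sub>v t = pad (vec k (\<lambda>i. (dual_mat *\<^sub>v t) $ i))"
      by (intro eq_vecI) (auto simp: pad_def simp del: index_mult_mat_vec)
    then show "\<exists>c\<in>carrier_vec k. dual_mat *\<^sub>v t = pad c" by (rule bexI) simp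
  qed (auto simp: pad_def simp del: index_mult_mat_vec)
  also have "\<dots> \<longleftrightarrow> (\<exists>c\<in>carrier_vec k. t = basis_mat_real\<^sup>T *\<^sub>v pad c)"
  proof -
    have "dual_mat *\<^sub>v t = pad c \<longleftrightarrow> t = basis_mat_real\<^sup>T *\<^sub>v pad c" for c
      using basis_dual_inverse_mult[OF t] dual_basis_inverse_mult[OF pad_carrier, of c] by auto
    then show ?thesis by simp
  qed
  also have "\<dots> \<longleftrightarrow> (\<exists>c\<in>carrier_vec k. t = relation_mat_real\<^sup>T *\<^sub>v c)"
    using relation_mat_real_transpose by auto
  finally show ?thesis .
qed

section \<open>The rational dimension of the coordinates\<close>

text \<open>The coordinates of \<open>\<alpha>\<close> with respect to the dual basis.\<close>
definition \<beta> :: "nat \<Rightarrow> real" where "\<beta> i = real_of_int_vec (row basis_mat i) \<bullet> \<alpha>"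

lemma basis_mat_scalar_alpha:
  assumes "c \<in> carrier_vec m"
  shows "real_of_int_vec (basis_mat\<^sup>T *\<^sub>v c) \<bullet> \<alpha> = (\<Sum>i<m. of_int (c $ i) * \<beta> i)"
  using transpose_mult_scalar_prod[OF basis_mat_carrier assms alpha] by (simp add: \<beta>_def)

text \<open>A relation between the \<open>\<beta> i\<close> is a relation between the coordinates of \<open>\<alpha>\<close>, hence a combination
  of the first \<open>k\<close> basis vectors; uniqueness of coordinates then kills the later coefficients. In
  particular \<open>\<beta> i = 0\<close> for \<open>i < k\<close>, and the remaining \<open>\<beta> i\<close> are rationally independent.\<close>
lemma relation_iff:
  assumes c: "c \<in> carrier_vec m"
  shows "(\<Sum>i<m. of_int (c $ i) * \<beta> i) = 0 \<longleftrightarrow> (\<forall>i<m. k \<le> i \<longrightarrow> c $ i = 0)"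
proof -
  have "basis_mat\<^sup>T *\<^sub>v c \<in> carrier_vec (dim_vec \<alpha>)"
    using alpha by (intro carrier_vecI) simp
  then have "(\<Sum>i<m. of_int (c $ i) * \<beta> i) = 0 \<longleftrightarrow> basis_mat\<^sup>T *\<^sub>v c \<in> relation_lattice \<alpha>"
    unfolding relation_lattice_def basis_mat_scalar_alpha[OF c, symmetric] by blast
  also have "\<dots> \<longleftrightarrow> (\<exists>d\<in>carrier_vec k. basis_mat\<^sup>T *\<^sub>v c = relation_mat\<^sup>T *\<^sub>v d)"
    unfolding relation_lattice_eq by blast
  also have "\<dots> \<longleftrightarrow> (\<exists>d\<in>carrier_vec k. c = pad d)"
  proof (rule bex_cong[OF refl])
    fix d :: "int vec" assume "d \<in> carrier_vec k"
    from relation_mat_transpose[OF this]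
    show "basis_mat\<^sup>T *\<^sub>v c = relation_mat\<^sup>T *\<^sub>v d \<longleftrightarrow> c = pad d"
      using basis_mat_inject[OF c pad_carrier, of d] by metis
  qed
  also have "\<dots> \<longleftrightarrow> (\<forall>i<m. k \<le> i \<longrightarrow> c $ i = 0)"
  proof
    assume tail: "\<forall>i<m. k \<le> i \<longrightarrow> c $ i = 0"
    have "c = pad (vec k (\<lambda>i. c $ i))"
    proof (rule eq_vecI)
      show "dim_vec c = dim_vec (pad (vec k (\<lambda>i. c $ i)))" using c by (simp add: pad_def)
      fix i assume "i < dim_vec (pad (vec k (\<lambda>i. c $ i)))"
      then show "c $ i = pad (vec k (\<lambda>i. c $ i)) $ i" using tail by (simp add: pad_def)
    qed
    then show "\<exists>d\<in>carrier_vec k. c = pad d" by (rule bexI) simp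
  qed (auto simp: pad_def)
  finally show ?thesis .
qed

text \<open>The \<open>\<beta> i\<close> with \<open>i \<ge> k\<close> form a basis of the rational span of the coordinates. Each \<open>\<beta> i\<close> is an
  integer combination of coordinates by definition; conversely every unit vector is an integer
  combination of the \<open>a ! i\<close>, because \<open>a\<close> generates the whole integer lattice.\<close>
lemma dim_rat_alpha: "dim_rat \<alpha> = m - k"
proof -
  have zero: "\<beta> i = 0" if "i < k" for i
  proof -
    have "(\<Sum>l<m. of_int (unit_vec m i $ l) * \<beta> l) = 0"
      unfolding relation_iff[OF unit_vec_carrier] using that k_le by auto
    also have "(\<Sum>l<m. of_int (unit_vec m i $ l) * \<beta> l) = (\<Sum>l<m. if l = i then \<beta> l else 0)"
      using that k_le by (intro sum.cong) auto
    finally show ?thesis using that k_le by simp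
  qed
  have ind: "inj_on \<beta> {k..<m} \<and> rat_real.independent (\<beta> ` {k..<m})"
  proof (subst rat_family_independent_iff, simp, intro allI impI ballI)
    fix c :: "nat \<Rightarrow> int" and i
    assume c: "(\<Sum>i\<in>{k..<m}. of_int (c i) * \<beta> i) = 0" and i: "i \<in> {k..<m}"
    have "(\<Sum>i<m. of_int (vec m c $ i) * \<beta> i) = (\<Sum>i\<in>{k..<m}. of_int (c i) * \<beta> i)"
      using zero by (intro sum.mono_neutral_cong_right) auto
    also have "\<dots> = 0" by (rule c)
    finally have "\<forall>i<m. k \<le> i \<longrightarrow> vec m c $ i = 0" unfolding relation_iff[OF vec_carrier] .
    then show "c i = 0" using i by simp
  qed
  have coords: "set\<^sub>v \<alpha> = (\<lambda>j. \<alpha> $ j) ` {..<m}"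
    using alpha by (auto simp: vec_set_def)
  have int_scale: "real_of_int q * x \<in> rat_real.span S" if "x \<in> rat_real.span S" for q x S
    using rat_real.span_scale[OF that, of "of_int q"] by simp
  have "rat_real.span (\<beta> ` {k..<m}) = rat_real.span (set\<^sub>v \<alpha>)"
  proof (rule rat_real.span_eq[THEN iffD2], intro conjI subsetI)
    fix x assume "x \<in> \<beta> ` {k..<m}"
    then obtain i where i: "i < m" "x = \<beta> i" by auto
    have "x = (\<Sum>j<m. of_int (basis_mat $$ (i, j)) * \<alpha> $ j)"
      using i alpha
      by (auto simp: \<beta>_def scalar_prod_def lessThan_atLeast0 intro!: sum.cong)
    also have "\<dots> \<in> rat_real.span (set\<^sub>v \<alpha>)"
      unfolding coords
      by (intro rat_real.span_sum int_scale rat_real.span_base imageI) auto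
    finally show "x \<in> rat_real.span (set\<^sub>v \<alpha>)" .
  next
    fix x assume "x \<in> set\<^sub>v \<alpha>"
    then obtain j where j: "j < m" "x = \<alpha> $ j" unfolding coords by auto
    have "unit_vec m j \<in> {basis_mat\<^sup>T *\<^sub>v c | c. c \<in> carrier_vec m}"
      unfolding basis_mat_def lattice_basis_coordinates[OF basis, unfolded length_a, symmetric]
      by (rule unit_vec_carrier)
    then obtain c where c: "c \<in> carrier_vec m" "unit_vec m j = basis_mat\<^sup>T *\<^sub>v c"
      by blast
    have "x = real_of_int_vec (basis_mat\<^sup>T *\<^sub>v c) \<bullet> \<alpha>"
    proof -
      have "real_of_int_vec (unit_vec m j) = unit_vec m j"
        by (intro eq_vecI) (auto simp: unit_vec_def)
      then show ?thesis using j alpha by (simp add: c(2)[symmetric])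
    qed
    also have "\<dots> = (\<Sum>i<m. of_int (c $ i) * \<beta> i)"
      by (rule basis_mat_scalar_alpha[OF c(1)])
    also have "\<dots> = (\<Sum>i\<in>{k..<m}. of_int (c $ i) * \<beta> i)"
      using zero by (intro sum.mono_neutral_right) auto
    also have "\<dots> \<in> rat_real.span (\<beta> ` {k..<m})"
      by (intro rat_real.span_sum int_scale rat_real.span_base imageI) auto
    finally show "x \<in> rat_real.span (\<beta> ` {k..<m})" .
  qed
  then have "rat_real.dim (set\<^sub>v \<alpha>) = card (\<beta> ` {k..<m})"
    using ind rat_real.dim_eq_card by blast
  then show ?thesis using ind by (simp add: dim_rat_def card_image)
qed

section \<open>Complementary selections\<close>

text \<open>A rational relation between the coordinates at \<open>J\<close> is, up to scaling, a lattice relation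
  supported on \<open>J\<close>, that is, an integer combination of the relation rows which vanishes off \<open>J\<close>.\<close>
lemma coordinates_independent_iff_rows:
  assumes J: "J \<subseteq> {..<m}"
  shows "inj_on (\<lambda>j. \<alpha> $ j) J \<and> rat_real.independent ((\<lambda>j. \<alpha> $ j) ` J) \<longleftrightarrow>
    (\<forall>c\<in>carrier_vec k. (\<forall>j\<in>{..<m} - J. (relation_mat\<^sup>T *\<^sub>v c) $ j = 0) \<longrightarrow> c = 0\<^sub>v k)"
proof -
  have fin: "finite J" using J finite_subset by blast
  have supp: "real_of_int_vec l \<bullet> \<alpha> = (\<Sum>j\<in>J. of_int (l $ j) * \<alpha> $ j)"
    if "l \<in> carrier_vec m" "\<forall>j\<in>{..<m} - J. l $ j = 0" for l
  proof -
    have "real_of_int_vec l \<bullet> \<alpha> = (\<Sum>j<m. of_int (l $ j) * \<alpha> $ j)"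
      using that alpha by (auto simp: scalar_prod_def lessThan_atLeast0 intro!: sum.cong)
    also have "\<dots> = (\<Sum>j\<in>J. of_int (l $ j) * \<alpha> $ j)"
      using J that by (intro sum.mono_neutral_right) auto
    finally show ?thesis .
  qed
  have "inj_on (\<lambda>j. \<alpha> $ j) J \<and> rat_real.independent ((\<lambda>j. \<alpha> $ j) ` J) \<longleftrightarrow>
    (\<forall>l\<in>relation_lattice \<alpha>. (\<forall>j\<in>{..<m} - J. l $ j = 0) \<longrightarrow> l = 0\<^sub>v m)"
    unfolding rat_family_independent_iff[OF fin]
  proof (intro iffI ballI allI impI)
    fix l assume norel: "\<forall>c::nat \<Rightarrow> int. (\<Sum>j\<in>J. of_int (c j) * \<alpha> $ j) = 0 \<longrightarrow> (\<forall>j\<in>J. c j = 0)"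
      and l: "l \<in> relation_lattice \<alpha>" "\<forall>j\<in>{..<m} - J. l $ j = 0"
    have lc: "l \<in> carrier_vec m" using l(1) alpha by (auto simp: relation_lattice_def)
    have "\<forall>j\<in>J. l $ j = 0"
      using norel supp[OF lc l(2)] l(1) by (simp add: relation_lattice_def)
    then show "l = 0\<^sub>v m" using l(2) lc by (intro eq_vecI) auto
  next
    fix c :: "nat \<Rightarrow> int" and i
    assume nol: "\<forall>l\<in>relation_lattice \<alpha>. (\<forall>j\<in>{..<m} - J. l $ j = 0) \<longrightarrow> l = 0\<^sub>v m"
      and c: "(\<Sum>j\<in>J. of_int (c j) * \<alpha> $ j) = 0" and i: "i \<in> J"
    define l where "l = vec m (\<lambda>j. if j \<in> J then c j else 0)"
    have l: "l \<in> carrier_vec m" "\<forall>j\<in>{..<m} - J. l $ j = 0" by (auto simp: l_def)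
    have "(\<Sum>j\<in>J. of_int (l $ j) * \<alpha> $ j) = 0"
      unfolding c[symmetric] using J by (intro sum.cong) (auto simp: l_def)
    then have "l \<in> relation_lattice \<alpha>"
      using supp[OF l] alpha l(1) by (simp add: relation_lattice_def)
    then have "l = 0\<^sub>v m" using nol l by blast
    then have "l $ i = 0" using i J by auto
    then show "c i = 0" using i J by (auto simp: l_def)
  qed
  also have "\<dots> \<longleftrightarrow>
      (\<forall>c\<in>carrier_vec k. (\<forall>j\<in>{..<m} - J. (relation_mat\<^sup>T *\<^sub>v c) $ j = 0) \<longrightarrow> relation_mat\<^sup>T *\<^sub>v c = 0\<^sub>v m)"
    unfolding relation_lattice_eq by blast
  also have "\<dots> \<longleftrightarrow>
      (\<forall>c\<in>carrier_vec k. (\<forall>j\<in>{..<m} - J. (relation_mat\<^sup>T *\<^sub>v c) $ j = 0) \<longrightarrow> c = 0\<^sub>v k)"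
  proof -
    have "c = 0\<^sub>v k" if "c \<in> carrier_vec k" "relation_mat\<^sup>T *\<^sub>v c = 0\<^sub>v m" for c
    proof -
      have "basis_mat\<^sup>T *\<^sub>v pad c = 0\<^sub>v m"
        using relation_mat_transpose[OF that(1), symmetric] that(2) by (rule trans)
      also have "0\<^sub>v m = basis_mat\<^sup>T *\<^sub>v 0\<^sub>v m" by (intro eq_vecI) auto
      finally have "basis_mat\<^sup>T *\<^sub>v pad c = basis_mat\<^sup>T *\<^sub>v 0\<^sub>v m" .
      then show ?thesis
        using basis_mat_inject[OF pad_carrier zero_carrier_vec] pad_inject[OF that(1)] by blast
    qed
    moreover have "relation_mat\<^sup>T *\<^sub>v 0\<^sub>v k = 0\<^sub>v m" by (intro eq_vecI) auto
    ultimately have "relation_mat\<^sup>T *\<^sub>v c = 0\<^sub>v m \<longleftrightarrow> c = 0\<^sub>v k" if "c \<in> carrier_vec k" for c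
      using that by blast
    then show ?thesis by (intro ball_cong[OF refl] imp_cong[OF refl])
  qed
  finally show ?thesis .
qed

text \<open>The counterpart of the previous lemma with real coefficients: kernel vectors of the associated
  matrix take the place of lattice relations.\<close>
lemma dual_columns_independent_iff_rows:
  assumes J: "J \<subseteq> {..<m}"
  shows "(\<forall>t\<in>carrier_vec m. (\<forall>j<m. j \<notin> J \<longrightarrow> t $ j = 0) \<longrightarrow>
      mat_of_rows m (drop k b) *\<^sub>v t = 0\<^sub>v (m - k) \<longrightarrow> t = 0\<^sub>v m) \<longleftrightarrow>
    (\<forall>c\<in>carrier_vec k. (\<forall>j\<in>{..<m} - J. (relation_mat_real\<^sup>T *\<^sub>v c) $ j = 0) \<longrightarrow> c = 0\<^sub>v k)"
    (is "?L \<longleftrightarrow> ?R")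
proof -
  have AT: "relation_mat_real\<^sup>T *\<^sub>v c \<in> carrier_vec m" for c by (intro carrier_vecI) simp
  have inject: "c = 0\<^sub>v k" if "c \<in> carrier_vec k" "relation_mat_real\<^sup>T *\<^sub>v c = 0\<^sub>v m" for c
  proof -
    have "pad c = dual_mat *\<^sub>v (basis_mat_real\<^sup>T *\<^sub>v pad c)"
      by (rule dual_basis_inverse_mult[OF pad_carrier, symmetric])
    also have "basis_mat_real\<^sup>T *\<^sub>v pad c = 0\<^sub>v m"
      using relation_mat_real_transpose[OF that(1), symmetric] that(2) by (rule trans)
    also have "dual_mat *\<^sub>v 0\<^sub>v m = 0\<^sub>v m" by (intro eq_vecI) auto
    finally show ?thesis by (rule pad_inject[OF that(1)])
  qed
  have zero: "relation_mat_real\<^sup>T *\<^sub>v 0\<^sub>v k = 0\<^sub>v m" by (intro eq_vecI) auto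
  show ?thesis
  proof (intro iffI ballI impI)
    fix c assume ?L and c: "c \<in> carrier_vec k" "\<forall>j\<in>{..<m} - J. (relation_mat_real\<^sup>T *\<^sub>v c) $ j = 0"
    moreover have "mat_of_rows m (drop k b) *\<^sub>v (relation_mat_real\<^sup>T *\<^sub>v c) = 0\<^sub>v (m - k)"
      unfolding kernel_annihilator_rows[OF AT] using c(1) by blast
    moreover have "\<forall>j<m. j \<notin> J \<longrightarrow> (relation_mat_real\<^sup>T *\<^sub>v c) $ j = 0" using c(2) by blast
    ultimately have "relation_mat_real\<^sup>T *\<^sub>v c = 0\<^sub>v m" using AT[of c] by (metis (no_types))
    then show "c = 0\<^sub>v k" by (rule inject[OF c(1)])
  next
    fix t assume ?R and t: "t \<in> carrier_vec m" "\<forall>j<m. j \<notin> J \<longrightarrow> t $ j = 0"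
      and "mat_of_rows m (drop k b) *\<^sub>v t = 0\<^sub>v (m - k)"
    then obtain c where c: "c \<in> carrier_vec k" "t = relation_mat_real\<^sup>T *\<^sub>v c"
      using kernel_annihilator_rows[OF t(1)] by blast
    have "\<forall>j\<in>{..<m} - J. (relation_mat_real\<^sup>T *\<^sub>v c) $ j = 0"
      using t(2) unfolding c(2) by blast
    then have "c = 0\<^sub>v k" using \<open>?R\<close> c(1) by blast
    then show "t = 0\<^sub>v m" using c(2) zero by simp
  qed
qed

text \<open>All sides amount to the nonvanishing of the minor of the relation matrix on the columns
  outside \<open>J\<close>. Rational independence sees it as an integer determinant, the other two as a real
  one.\<close>
lemma complementary_selections:
  assumes J: "J \<subseteq> {..<m}" and card: "card J = m - k"
  shows coordinates_iff_complementary_columns: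
      "inj_on (\<lambda>j. \<alpha> $ j) J \<and> rat_real.independent ((\<lambda>j. \<alpha> $ j) ` J) \<longleftrightarrow>
        independent_columns relation_mat_real ({..<m} - J)"
    and dual_columns_iff_complementary_columns:
      "independent_columns (mat_of_rows m (drop k b)) J \<longleftrightarrow>
        independent_columns relation_mat_real ({..<m} - J)"
proof -
  let ?I = "{..<m} - J"
  have I: "?I \<subseteq> {..<m}" by auto
  have "card ?I = k" using J card k_le by (simp add: card_Diff_subset finite_subset)
  then obtain e where e: "bij_betw e {..<k} ?I"
    using ex_bij_betw_nat_finite[of ?I] by (auto simp: lessThan_atLeast0)
  let ?N = "mat k k (\<lambda>(i, j). relation_mat $$ (i, e j))"
  let ?N_real = "mat k k (\<lambda>(i, j). relation_mat_real $$ (i, e j))"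
  have real_carrier: "relation_mat_real \<in> carrier_mat k m" by simp
  have "e j < m" if "j < k" for j
    using e that by (auto simp: bij_betw_def)
  then have "?N_real = map_mat real_of_int ?N"
    by (intro eq_matI) auto
  then have det: "det ?N_real \<noteq> 0 \<longleftrightarrow> det ?N \<noteq> 0" by simp
  have G: "independent_columns relation_mat_real ?I \<longleftrightarrow> det ?N_real \<noteq> 0"
    unfolding independent_columns_iff_no_supported_kernel[OF real_carrier I]
      minor_nonzero_iff_columns[OF real_carrier e I] ..
  show "inj_on (\<lambda>j. \<alpha> $ j) J \<and> rat_real.independent ((\<lambda>j. \<alpha> $ j) ` J) \<longleftrightarrow>
      independent_columns relation_mat_real ?I"
    unfolding G det minor_nonzero_iff_rows[OF relation_mat_carrier e I]
    by (rule coordinates_independent_iff_rows[OF J])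
  have "mat_of_rows m (drop k b) \<in> carrier_mat (m - k) m"
    using length_b by auto
  then show "independent_columns (mat_of_rows m (drop k b)) J \<longleftrightarrow>
      independent_columns relation_mat_real ?I"
    unfolding G minor_nonzero_iff_rows[OF real_carrier e I]
    using independent_columns_iff_no_supported_kernel J dual_columns_independent_iff_rows by metis
qed

lemma general_position_complement:
  "linear_general_position relation_mat_real \<longleftrightarrow>
    (\<forall>J\<subseteq>{..<m}. card J = m - k \<longrightarrow> independent_columns relation_mat_real ({..<m} - J))"
proof -
  have compl: "card ({..<m} - S) = m - card S" "{..<m} - ({..<m} - S) = S"
    if "S \<subseteq> {..<m}" for S
    using that by (auto simp: card_Diff_subset finite_subset)
  have gp: "linear_general_position relation_mat_real \<longleftrightarrow>
      (\<forall>I\<subseteq>{..<m}. card I = k \<longrightarrow> independent_columns relation_mat_real I)"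
    by (simp add: linear_general_position_iff)
  show ?thesis
    unfolding gp
  proof (intro iffI allI impI)
    fix J assume *: "\<forall>I\<subseteq>{..<m}. card I = k \<longrightarrow> independent_columns relation_mat_real I"
      and J: "J \<subseteq> {..<m}" "card J = m - k"
    show "independent_columns relation_mat_real ({..<m} - J)"
      by (rule *[rule_format]) (use compl(1)[OF J(1)] J(2) k_le in auto)
  next
    fix I assume *: "\<forall>J\<subseteq>{..<m}. card J = m - k \<longrightarrow>
        independent_columns relation_mat_real ({..<m} - J)"
      and I: "I \<subseteq> {..<m}" "card I = k"
    have "independent_columns relation_mat_real ({..<m} - ({..<m} - I))"
      by (rule *[rule_format]) (use I compl(1)[OF I(1)] in auto)
    then show "independent_columns relation_mat_real I" by (simp only: compl(2)[OF I(1)])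
  qed
qed

lemma rationally_uniform_iff_general_position:
  "rationally_uniform \<alpha> \<longleftrightarrow> linear_general_position relation_mat_real"
proof -
  have "dim_vec \<alpha> = m" using alpha by simp
  then show ?thesis
    unfolding general_position_complement rationally_uniform_def dim_rat_alpha
    using coordinates_iff_complementary_columns by simp
qed

lemma general_position_iff_dual:
  "linear_general_position relation_mat_real \<longleftrightarrow> linear_general_position (mat_of_rows m (drop k b))"
  unfolding general_position_complement linear_general_position_iff[of "mat_of_rows m (drop k b)"]
  using dual_columns_iff_complementary_columns length_b by simp

end

theorem corollary3p5:
  fixes m n :: nat and \<alpha> :: "real vec"
    and a :: "int vec list" and a_star :: "real vec list"
    and A A_perp :: "real mat" and Z Z_perp :: "real vec set"
  assumes "\<alpha> \<in> carrier_vec m"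
    and "n = relation_dim \<alpha>"
    and "length a = m"
    and "lattice_basis m (take n a) (relation_lattice \<alpha>)"
    and "lattice_basis m a (carrier_vec m)"
    and "dual_basis m a a_star"
    and "A = mat_of_rows m (map real_of_int_vec (take n a))"
    and "A_perp = mat_of_rows m (drop n a_star)"
    and "Z = zonotope A"
    and "Z_perp = zonotope A_perp"
  shows "(rationally_uniform \<alpha> \<longleftrightarrow> generated_in_general_position Z A) \<and>
         (generated_in_general_position Z A \<longleftrightarrow> generated_in_general_position Z_perp A_perp)"
proof -
  let ?k = "min n m"
  \<comment> \<open>Cutting \<open>n\<close> off at \<open>m\<close> changes neither list and supplies the bound \<open>k \<le> m\<close> of the locale.\<close>
  have take: "take ?k a = take n a" and drop: "drop ?k a_star = drop n a_star"
    using assms(3,6) by (auto simp: min_def dual_basis_def)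
  interpret adapted_basis m ?k \<alpha> a a_star
    by unfold_locales (use assms take in auto)
  have "set (take n a) \<subseteq> carrier_vec m"
    using a_carrier set_take_subset by fast
  then have "A = map_mat real_of_int relation_mat"
    unfolding assms(7) relation_mat_def take by (rule mat_of_rows_real_of_int)
  then show ?thesis
    using rationally_uniform_iff_general_position general_position_iff_dual
    by (simp add: generated_in_general_position_def assms(8-10) drop)
qed

end
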